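(* For any $\epsilon>0$ such that $\mathcal{L}_\epsilon\neq\emptyset$, we have $\rho_\epsilon\ge\frac{\epsilon}{B_\epsilon}$, and for any $\mathbf{w}\in\Omega$ $$\|\mathbf{w}-\mathbf{w}_\epsilon^\dagger\|_2\le\frac{\|\mathbf{w}_\epsilon^\dagger-\mathbf{w}_\epsilon^*\|_2}{\epsilon}\left(f(\mathbf{w})-f(\mathbf{w}_\epsilon^\dagger)\right)\le\frac{B_\epsilon}{\epsilon}\left(f(\mathbf{w})-f(\mathbf{w}_\epsilon^\dagger)\right),$$ where $\mathbf{w}_\epsilon^*$ is the closest point in $\Omega_*$ to $\mathbf{w}_\epsilon^\dagger$.
   Context: $f:\mathbb{R}^d\to(-\infty,+\infty]$ is lower semicontinuous and convex, $\Omega\subseteq\mathrm{dom}(f)$ is a closed convex subset of $\mathbb{R}^d$, $f_*:=\min_{\mathbf{w}\in\Omega}f(\mathbf{w})$ is attained, and $\Omega_*\subseteq\Omega$ is the (nonempty) set of minimizers of $f$ over $\Omega$. There is a constant $G$ such that for every $\mathbf{w}\in\Omega$ the subdifferential $\partial f(\mathbf{w})$ is nonempty and $\|\mathbf{v}\|_2\le G$ for all $\mathbf{v}\in\partial f(\mathbf{w})$. $\mathcal{L}_\epsilon:=\{\mathbf{w}\in\Omega:f(\mathbf{w})=f_*+\epsilon\}$, $\mathcal{S}_\epsilon:=\{\mathbf{w}\in\Omega:f(\mathbf{w})\le f_*+\epsilon\}$. $\mathbf{w}_\epsilon^\dagger:=\arg\min_{\mathbf{u}\in\mathcal{S}_\epsilon}\|\mathbf{u}-\mathbf{w}\|_2^2$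 is the point of $\mathcal{S}_\epsilon$ closest to $\mathbf{w}$. $B_\epsilon:=\sup_{\mathbf{w}\in\mathcal{L}_\epsilon}\min_{\mathbf{u}\in\Omega_*}\|\mathbf{w}-\mathbf{u}\|_2$, which is assumed finite. $\mathcal{N}_\Omega(\mathbf{w})=\{\mathbf{v}\in\mathbb{R}^d:\mathbf{v}^\top(\mathbf{u}-\mathbf{w})\le0\ \forall\mathbf{u}\in\Omega\}$ is the normal cone, and $$\rho_\epsilon:=\inf_{\mathbf{w}\in\mathcal{L}_\epsilon}\ \inf_{\mathbf{g}\in\partial f(\mathbf{w}),\,\mathbf{v}\in\mathcal{N}_\Omega(\mathbf{w})}\|\mathbf{g}+\mathbf{v}\|_2 .$$ *)

theory Defs
  imports "HOL-Analysis.Analysis"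
begin

definition ereal_dom :: "('a \<Rightarrow> ereal) \<Rightarrow> 'a set"
  where "ereal_dom f = {x. f x < \<infinity>}"

definition lower_semicontinuous :: "('a::topological_space \<Rightarrow> ereal) \<Rightarrow> bool"
  where "lower_semicontinuous f \<longleftrightarrow> (\<forall>x. f x \<le> Liminf (at x) f)"

text \<open>Intended for functions avoiding \<open>-\<infinity>\<close>, so that the right-hand side is never an
  \<open>\<infinity> - \<infinity>\<close>; at the endpoints \<open>u = 0\<close> and \<open>v = 0\<close> the library convention \<open>0 * \<infinity> = 0\<close>
  makes the inequality trivial.\<close>

definition ereal_convex :: "('a::real_vector \<Rightarrow> ereal) \<Rightarrow> bool"
  where "ereal_convex f \<longleftrightarrow>
    (\<forall>x y. \<forall>u\<ge>0. \<forall>v\<ge>0. u + v = 1 \<longrightarrow>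
      f (u *\<^sub>R x + v *\<^sub>R y) \<le> ereal u * f x + ereal v * f y)"

definition subdifferential :: "('a::real_inner \<Rightarrow> ereal) \<Rightarrow> 'a \<Rightarrow> 'a set"
  where "subdifferential f w = {g. \<forall>u. f u \<ge> f w + ereal (g \<bullet> (u - w))}"

definition normal_cone :: "'a::real_inner set \<Rightarrow> 'a \<Rightarrow> 'a set"
  where "normal_cone \<Omega> w = {v. \<forall>u\<in>\<Omega>. v \<bullet> (u - w) \<le> 0}"

definition min_value :: "('a \<Rightarrow> ereal) \<Rightarrow> 'a set \<Rightarrow> ereal"
  where "min_value f \<Omega> = (INF w\<in>\<Omega>. f w)"

definition minimizers :: "('a \<Rightarrow> ereal) \<Rightarrow> 'a set \<Rightarrow> 'a set"
  where "minimizers f \<Omega> = {w. is_arg_min f (\<lambda>u. u \<in> \<Omega>) w}"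

definition level_set :: "('a \<Rightarrow> ereal) \<Rightarrow> 'a set \<Rightarrow> real \<Rightarrow> 'a set"
  where "level_set f \<Omega> \<epsilon> = {w\<in>\<Omega>. f w = min_value f \<Omega> + ereal \<epsilon>}"

definition sublevel_set :: "('a \<Rightarrow> ereal) \<Rightarrow> 'a set \<Rightarrow> real \<Rightarrow> 'a set"
  where "sublevel_set f \<Omega> \<epsilon> = {w\<in>\<Omega>. f w \<le> min_value f \<Omega> + ereal \<epsilon>}"

text \<open>The supremum and the infima below are taken in \<^typ>\<open>ereal\<close>, so that they are genuine
  without any boundedness assumption. The inner minimum over the minimizers is \<^const>\<open>infdist\<close>,
  which is attained because the set of minimizers is nonempty and closed in the intended setting.\<close>

definition max_dist :: "('a::metric_space \<Rightarrow> ereal) \<Rightarrow> 'a set \<Rightarrow> real \<Rightarrow> ereal"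
  where "max_dist f \<Omega> \<epsilon> = (SUP w\<in>level_set f \<Omega> \<epsilon>. ereal (infdist w (minimizers f \<Omega>)))"

definition min_subgrad_norm :: "('a::real_inner \<Rightarrow> ereal) \<Rightarrow> 'a set \<Rightarrow> real \<Rightarrow> ereal"
  where "min_subgrad_norm f \<Omega> \<epsilon> =
    (INF w\<in>level_set f \<Omega> \<epsilon>. INF (g, v)\<in>subdifferential f w \<times> normal_cone \<Omega> w. ereal (norm (g + v)))"

end

theory Submission
  imports Defs
begin

text \<open>
  Write \<open>m\<close> for the minimum of \<open>f\<close> over \<open>\<Omega>\<close>.

  For the bound on \<open>\<rho>\<^sub>\<epsilon>\<close>, the subgradient inequality and the normal cone inequality at a point \<open>w\<close>
  of the level set are both tested in the direction of the minimizer \<open>u\<close> closest to \<open>w\<close>. Their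
  sum gives \<open>\<epsilon> \<le> - (g + v) \<bullet> (u - w)\<close>, and Cauchy-Schwarz finishes
  (\<open>subgradient_plus_normal_bound\<close>).

  The error bound is a comparison along segments. If \<open>w\<close> lies in the sublevel set, then
  \<open>w\<^sub>\<epsilon>\<^sup>\<dagger> = w\<close> and all terms vanish. Otherwise, going from a point \<open>u\<close> of the sublevel set straight to
  \<open>w\<close>, convexity of \<open>f\<close> guarantees that one stays in the sublevel set up to a certain fraction of
  the way, which bounds the distance from \<open>w\<close> to that set
  (\<open>dist_closest_point_convex_sublevel\<close>). This estimate is used twice. With \<open>u\<close> the projection
  \<open>w\<^sub>\<epsilon>\<^sup>\<dagger>\<close> itself, it shows that \<open>w\<^sub>\<epsilon>\<^sup>\<dagger>\<close> lies on the level set, so that its distance to the minimizers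
  is at most \<open>B\<^sub>\<epsilon>\<close>. With \<open>u\<close> a minimizer and \<open>D = f w - (m + \<epsilon>)\<close>, it reads
  \<open>(\<epsilon> + D) * dist w w\<^sub>\<epsilon>\<^sup>\<dagger> \<le> D * dist w u\<close>; the triangle inequality through \<open>w\<^sub>\<epsilon>\<^sup>\<dagger>\<close> bounds the right-hand
  side by \<open>D * dist w w\<^sub>\<epsilon>\<^sup>\<dagger> + D * dist w\<^sub>\<epsilon>\<^sup>\<dagger> u\<close>, and cancelling leaves the claim
  (\<open>error_bound_convex_sublevel\<close>).

  Lower semicontinuity makes the sublevel sets closed, so that the projections onto them and onto the set of
  minimizers, which is the sublevel set for \<open>\<epsilon> = 0\<close>, are genuine closest points.
\<close>

lemma closed_sublevel_lower_semicontinuous: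
  assumes "lower_semicontinuous f"
  shows "closed {x. f x \<le> c}"
proof -
  have "open {x. c < f x}"
  proof (subst open_subopen, safe)
    fix x assume x: "c < f x"
    have "c < Liminf (at x) f"
      using x assms unfolding lower_semicontinuous_def by (metis less_le_trans)
    then have "eventually (\<lambda>y. c < f y) (at x)"
      by (rule less_LiminfD)
    with x have "eventually (\<lambda>y. c < f y) (nhds x)"
      by (simp add: eventually_nhds_conv_at)
    then show "\<exists>T. open T \<and> x \<in> T \<and> T \<subseteq> {x. c < f x}"
      unfolding eventually_nhds by blast
  qed
  moreover have "{x. f x \<le> c} = - {x. c < f x}" by auto
  ultimately show ?thesis by (simp add: closed_def)
qed

lemma convex_on_real_of_ereal:
  assumes "ereal_convex f" "convex \<Omega>" "\<And>x. x \<in> \<Omega> \<Longrightarrow> \<bar>f x\<bar> \<noteq> \<infinity>"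
  shows "convex_on \<Omega> (\<lambda>x. real_of_ereal (f x))"
proof (rule convex_onI)
  fix t :: real and x y assume t: "0 < t" "t < 1" and xy: "x \<in> \<Omega>" "y \<in> \<Omega>"
  let ?z = "(1 - t) *\<^sub>R x + t *\<^sub>R y"
  have z: "?z \<in> \<Omega>"
    using assms(2) xy t by (simp add: convexD)
  have "f ?z \<le> ereal (1 - t) * f x + ereal t * f y"
    using assms(1) t unfolding ereal_convex_def by auto
  then show "real_of_ereal (f ?z) \<le> (1 - t) * real_of_ereal (f x) + t * real_of_ereal (f y)"
    using assms(3)[OF xy(1)] assms(3)[OF xy(2)] assms(3)[OF z]
    by (cases "f x"; cases "f y"; cases "f ?z") auto
qed (rule assms(2))

lemma minimizers_eq_sublevel_set:
  "minimizers f \<Omega> = sublevel_set f \<Omega> 0"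
proof -
  have "w \<in> \<Omega> \<and> (\<forall>u\<in>\<Omega>. \<not> f u < f w) \<longleftrightarrow> w \<in> \<Omega> \<and> f w \<le> (INF u\<in>\<Omega>. f u)" for w
    by (auto simp: le_INF_iff not_less)
  then show ?thesis
    unfolding minimizers_def sublevel_set_def min_value_def is_arg_min_def
    by (auto simp flip: zero_ereal_def)
qed

lemma min_value_eq_if_minimizer:
  assumes "u \<in> minimizers f \<Omega>"
  shows "min_value f \<Omega> = f u"
proof (rule antisym)
  show "min_value f \<Omega> \<le> f u"
    using assms unfolding min_value_def minimizers_def is_arg_min_def by (auto intro: INF_lower)
  show "f u \<le> min_value f \<Omega>"
    using assms unfolding min_value_def minimizers_def is_arg_min_def
    by (auto intro: INF_greatest simp: not_less)
qed

lemma subgradient_plus_normal_bound: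
  assumes g: "g \<in> subdifferential f w" and v: "v \<in> normal_cone \<Omega> w" and u: "u \<in> \<Omega>"
    and fw: "f w = ereal a" and fu: "f u = ereal b"
  shows "a - b \<le> norm (g + v) * dist w u"
proof -
  have "f w + ereal (g \<bullet> (u - w)) \<le> f u"
    using g unfolding subdifferential_def by auto
  then have "a + g \<bullet> (u - w) \<le> b"
    by (simp add: fw fu)
  moreover have "v \<bullet> (u - w) \<le> 0"
    using v u unfolding normal_cone_def by auto
  ultimately have "a - b \<le> - ((g + v) \<bullet> (u - w))"
    by (simp add: inner_add_left)
  also have "\<dots> \<le> norm (g + v) * norm (u - w)"
    using Cauchy_Schwarz_ineq2[of "g + v" "u - w"] by linarith
  finally show ?thesis
    by (simp add: dist_norm norm_minus_commute)
qed

text \<open>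
  On the segment from \<open>u\<close> to \<open>w\<close>, convexity keeps \<open>F\<close> below its chord. The chord takes the value
  \<open>c\<close> at the point \<open>z\<close> whose distance to \<open>w\<close> is the fraction \<open>(F w - c) / (F w - F u)\<close> of the
  length of the segment, and \<open>z\<close> competes with the closest point.
\<close>

lemma dist_closest_point_convex_sublevel:
  fixes F :: "'a::euclidean_space \<Rightarrow> real"
  assumes conv: "convex_on \<Omega> F" and closed: "closed {x \<in> \<Omega>. F x \<le> c}"
    and u: "u \<in> \<Omega>" "F u \<le> c" and w: "w \<in> \<Omega>" "c < F w"
  shows "(F w - F u) * dist w (closest_point {x \<in> \<Omega>. F x \<le> c} w) \<le> (F w - c) * dist w u"
proof -
  define t where "t = (c - F u) / (F w - F u)"
  have pos: "0 < F w - F u"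
    using u w by simp
  have t: "0 \<le> t" "t \<le> 1" and t_compl: "(F w - F u) * (1 - t) = F w - c"
    and t_chord: "(F w - F u) * t = c - F u"
    using pos u w by (auto simp: t_def field_simps)
  define z where "z = (1 - t) *\<^sub>R u + t *\<^sub>R w"
  have "F z \<le> (1 - t) * F u + t * F w"
    unfolding z_def using convex_onD[OF conv] t u w by simp
  also have "\<dots> = c"
    using t_chord by (simp add: algebra_simps)
  finally have "z \<in> {x \<in> \<Omega>. F x \<le> c}"
    using convexD[OF convex_on_imp_convex[OF conv] u(1) w(1)] t by (simp add: z_def)
  then have "dist w (closest_point {x \<in> \<Omega>. F x \<le> c} w) \<le> dist w z"
    by (rule closest_point_le[OF closed])
  also have "dist w z = (1 - t) * dist w u"
  proof -
    have "w - z = (1 - t) *\<^sub>R (w - u)"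
      by (simp add: z_def algebra_simps)
    then show ?thesis
      using t by (simp add: dist_norm)
  qed
  finally have "(F w - F u) * dist w (closest_point {x \<in> \<Omega>. F x \<le> c} w)
      \<le> (F w - F u) * ((1 - t) * dist w u)"
    using pos by (intro mult_left_mono) auto
  also have "\<dots> = (F w - c) * dist w u"
    using t_compl by (metis mult.assoc)
  finally show ?thesis .
qed

text \<open>
  If the value at the closest point were below \<open>c\<close>, the segment towards \<open>w\<close> would stay in the
  sublevel set for a while and get closer to \<open>w\<close>.
\<close>

lemma closest_point_convex_sublevel_on_level:
  fixes F :: "'a::euclidean_space \<Rightarrow> real"
  assumes conv: "convex_on \<Omega> F" and closed: "closed {x \<in> \<Omega>. F x \<le> c}"
    and ne: "{x \<in> \<Omega>. F x \<le> c} \<noteq> {}" and w: "w \<in> \<Omega>" "c < F w"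
  shows "F (closest_point {x \<in> \<Omega>. F x \<le> c} w) = c"
proof -
  define a where "a = closest_point {x \<in> \<Omega>. F x \<le> c} w"
  have "a \<in> {x \<in> \<Omega>. F x \<le> c}"
    unfolding a_def by (rule closest_point_in_set[OF closed ne])
  then have a: "a \<in> \<Omega>" "F a \<le> c" by auto
  have "0 < dist w a"
    using a w by auto
  moreover have "(F w - F a) * dist w a \<le> (F w - c) * dist w a"
    using dist_closest_point_convex_sublevel[OF conv closed a w] by (simp add: a_def)
  ultimately have "F w - F a \<le> F w - c"
    by (simp add: mult_le_cancel_right)
  with a show ?thesis
    by (simp add: a_def)
qed

text \<open>
  The travel estimate compares with \<open>dist w u\<close>; replacing it by \<open>dist w a + dist a u\<close>, where \<open>a\<close> is
  the closest point, moves the comparison to the distance between \<open>a\<close> and \<open>u\<close>.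
\<close>

lemma error_bound_convex_sublevel:
  fixes F :: "'a::euclidean_space \<Rightarrow> real"
  assumes conv: "convex_on \<Omega> F" and closed: "closed {x \<in> \<Omega>. F x \<le> c}"
    and u: "u \<in> \<Omega>" "F u \<le> c" and w: "w \<in> \<Omega>" "c < F w"
  defines "a \<equiv> closest_point {x \<in> \<Omega>. F x \<le> c} w"
  shows "(c - F u) * dist w a \<le> dist a u * (F w - c)"
proof -
  have "(F w - F u) * dist w a \<le> (F w - c) * dist w u"
    unfolding a_def by (rule dist_closest_point_convex_sublevel[OF conv closed u w])
  also have "\<dots> \<le> (F w - c) * (dist w a + dist a u)"
    using w by (intro mult_left_mono dist_triangle) auto
  finally show ?thesis
    by (simp add: algebra_simps)
qed

theorem lemma4:
  fixes f :: "real ^ 'd \<Rightarrow> ereal" and \<Omega> :: "(real ^ 'd) set" and G \<epsilon> :: real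
  assumes f_not_MInf: "\<forall>w. f w \<noteq> -\<infinity>"
    and f_lsc: "lower_semicontinuous f"
    and f_convex: "ereal_convex f"
    and \<Omega>_dom: "\<Omega> \<subseteq> ereal_dom f"
    and \<Omega>_closed: "closed \<Omega>"
    and \<Omega>_convex: "convex \<Omega>"
    and min_attained: "minimizers f \<Omega> \<noteq> {}"
    and subgrad: "\<forall>w\<in>\<Omega>. subdifferential f w \<noteq> {} \<and> (\<forall>v\<in>subdifferential f w. norm v \<le> G)"
    and \<epsilon>_pos: "\<epsilon> > 0"
    and level_ne: "level_set f \<Omega> \<epsilon> \<noteq> {}"
    and max_dist_finite: "max_dist f \<Omega> \<epsilon> < \<infinity>"
  shows "min_subgrad_norm f \<Omega> \<epsilon> \<ge> ereal \<epsilon> / max_dist f \<Omega> \<epsilon> \<and>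
    (\<forall>w\<in>\<Omega>.
      let w_dag = closest_point (sublevel_set f \<Omega> \<epsilon>) w;
          w_star = closest_point (minimizers f \<Omega>) w_dag
      in ereal (norm (w - w_dag)) \<le> ereal (norm (w_dag - w_star) / \<epsilon>) * (f w - f w_dag) \<and>
         ereal (norm (w_dag - w_star) / \<epsilon>) * (f w - f w_dag)
           \<le> max_dist f \<Omega> \<epsilon> / ereal \<epsilon> * (f w - f w_dag))"
proof (intro conjI ballI)
  define F where "F = (\<lambda>x. real_of_ereal (f x))"
  define B where "B = real_of_ereal (max_dist f \<Omega> \<epsilon>)"
  have fin: "\<bar>f x\<bar> \<noteq> \<infinity>" if "x \<in> \<Omega>" for x
  proof -
    have "f x < \<infinity>"
      using that \<Omega>_dom unfolding ereal_dom_def by blast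
    then show ?thesis
      using f_not_MInf[rule_format, of x] by (cases "f x") auto
  qed
  have F: "f x = ereal (F x)" if "x \<in> \<Omega>" for x
    using fin[OF that] by (simp add: F_def ereal_real)
  have conv: "convex_on \<Omega> F"
    unfolding F_def by (rule convex_on_real_of_ereal[OF f_convex \<Omega>_convex fin])
  obtain u0 where u0: "u0 \<in> minimizers f \<Omega>"
    using min_attained by blast
  define m where "m = F u0"
  have minimizers_sub: "minimizers f \<Omega> \<subseteq> \<Omega>"
    unfolding minimizers_def is_arg_min_def by auto
  have min_val: "min_value f \<Omega> = ereal m"
    using min_value_eq_if_minimizer[OF u0] u0 minimizers_sub F by (auto simp: m_def)
  have F_min: "F p = m" if "p \<in> minimizers f \<Omega>" for p
    using min_value_eq_if_minimizer[OF that] min_val F that minimizers_sub by auto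
  have sublevel: "sublevel_set f \<Omega> \<delta> = {x \<in> \<Omega>. F x \<le> m + \<delta>}" for \<delta>
    unfolding sublevel_set_def min_val by (auto simp: F)
  have level: "level_set f \<Omega> \<delta> = {x \<in> \<Omega>. F x = m + \<delta>}" for \<delta>
    unfolding level_set_def min_val by (auto simp: F)
  have closed_sub: "closed (sublevel_set f \<Omega> \<delta>)" for \<delta>
  proof -
    have "sublevel_set f \<Omega> \<delta> = \<Omega> \<inter> {x. f x \<le> min_value f \<Omega> + ereal \<delta>}"
      unfolding sublevel_set_def by auto
    then show ?thesis
      using \<Omega>_closed closed_sublevel_lower_semicontinuous[OF f_lsc] by (simp add: closed_Int)
  qed
  have closed_min: "closed (minimizers f \<Omega>)"
    unfolding minimizers_eq_sublevel_set by (rule closed_sub)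
  define proj where "proj x = closest_point (minimizers f \<Omega>) x" for x
  have proj: "proj x \<in> minimizers f \<Omega>" for x
    unfolding proj_def by (rule closest_point_in_set[OF closed_min min_attained])
  have dist_proj_le: "ereal (dist x (proj x)) \<le> max_dist f \<Omega> \<epsilon>" if "x \<in> level_set f \<Omega> \<epsilon>" for x
  proof -
    have "dist x (proj x) = infdist x (minimizers f \<Omega>)"
      unfolding proj_def infdist_eq_setdist by (simp add: setdist_closest_point[OF closed_min min_attained])
    then show ?thesis
      unfolding max_dist_def using that by (auto intro: SUP_upper)
  qed
  have level_not_min: "0 < dist x (proj x)" if "x \<in> level_set f \<Omega> \<epsilon>" for x
  proof -
    have "F x \<noteq> F (proj x)"
      using that F_min[OF proj] \<epsilon>_pos by (simp add: level)
    then show ?thesis by auto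
  qed
  obtain x0 where x0: "x0 \<in> level_set f \<Omega> \<epsilon>"
    using level_ne by blast
  have B: "max_dist f \<Omega> \<epsilon> = ereal B"
    using dist_proj_le[OF x0] max_dist_finite unfolding B_def
    by (cases "max_dist f \<Omega> \<epsilon>") auto
  \<comment> \<open>The value at \<open>x0\<close> exceeds the minimum, so \<open>x0\<close> is not a minimizer; hence dividing by \<open>B\<close> is
    division by a positive real, unaffected by the conventions of \<^typ>\<open>ereal\<close>.\<close>
  have B_pos: "0 < B"
    using dist_proj_le[OF x0] level_not_min[OF x0] unfolding B ereal_less_eq by (rule less_le_trans[rotated])

  show "ereal \<epsilon> / max_dist f \<Omega> \<epsilon> \<le> min_subgrad_norm f \<Omega> \<epsilon>"
    unfolding min_subgrad_norm_def
  proof (intro INF_greatest, clarify)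
    fix w g v
    assume w: "w \<in> level_set f \<Omega> \<epsilon>"
      and gv: "g \<in> subdifferential f w" "v \<in> normal_cone \<Omega> w"
    have w\<Omega>: "w \<in> \<Omega>" and p\<Omega>: "proj w \<in> \<Omega>"
      using w proj minimizers_sub by (auto simp: level)
    have "F w - F (proj w) \<le> norm (g + v) * dist w (proj w)"
      by (rule subgradient_plus_normal_bound[where f = f and \<Omega> = \<Omega>, OF gv p\<Omega> F[OF w\<Omega>] F[OF p\<Omega>]])
    also have "\<dots> \<le> norm (g + v) * B"
      using dist_proj_le[OF w] by (simp add: B mult_left_mono)
    also have "F w - F (proj w) = \<epsilon>"
      using w F_min[OF proj] by (simp add: level)
    finally show "ereal \<epsilon> / max_dist f \<Omega> \<epsilon> \<le> ereal (norm (g + v))"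
      using B_pos by (simp add: B divide_le_eq)
  qed

  fix w assume w: "w \<in> \<Omega>"
  let ?S = "sublevel_set f \<Omega> \<epsilon>"
  define a where "a = closest_point ?S w"
  have S_ne: "?S \<noteq> {}"
    using x0 by (auto simp: level sublevel)
  have "a \<in> ?S"
    unfolding a_def by (rule closest_point_in_set[OF closed_sub S_ne])
  then have a: "a \<in> \<Omega>" by (simp add: sublevel)
  have "ereal (norm (w - a)) \<le> ereal (norm (a - proj a) / \<epsilon>) * (f w - f a) \<and>
        ereal (norm (a - proj a) / \<epsilon>) * (f w - f a)
          \<le> max_dist f \<Omega> \<epsilon> / ereal \<epsilon> * (f w - f a)"
  proof (cases "w \<in> ?S")
    case True
    then have "a = w"
      unfolding a_def by (rule closest_point_self)
    then show ?thesis
      using F[OF w] \<epsilon>_pos by (simp add: B)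
  next
    case False
    then have w_gt: "m + \<epsilon> < F w"
      using w by (simp add: sublevel)
    note closed = closed_sub[of \<epsilon>, unfolded sublevel]
    have Fa: "F a = m + \<epsilon>"
      using closest_point_convex_sublevel_on_level[OF conv closed _ w w_gt] S_ne
      by (simp add: a_def sublevel)
    then have a_level: "a \<in> level_set f \<Omega> \<epsilon>"
      using a by (simp add: level)
    have "proj a \<in> \<Omega>" "F (proj a) \<le> m + \<epsilon>"
      using proj minimizers_sub F_min[OF proj] \<epsilon>_pos by auto
    from error_bound_convex_sublevel[OF conv closed this w w_gt]
    have "\<epsilon> * dist w a \<le> dist a (proj a) * (F w - F a)"
      using F_min[OF proj] Fa by (simp add: a_def sublevel)
    then have "norm (w - a) \<le> norm (a - proj a) / \<epsilon> * (F w - F a)"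
      using \<epsilon>_pos by (simp add: dist_norm field_simps)
    moreover have "norm (a - proj a) / \<epsilon> * (F w - F a) \<le> B / \<epsilon> * (F w - F a)"
      using dist_proj_le[OF a_level] w_gt Fa \<epsilon>_pos
      by (intro mult_right_mono divide_right_mono) (auto simp: B dist_norm)
    ultimately show ?thesis
      using F[OF w] F[OF a] \<epsilon>_pos by (simp add: B)
  qed
  then show "let w_dag = closest_point (sublevel_set f \<Omega> \<epsilon>) w;
          w_star = closest_point (minimizers f \<Omega>) w_dag
      in ereal (norm (w - w_dag)) \<le> ereal (norm (w_dag - w_star) / \<epsilon>) * (f w - f w_dag) \<and>
         ereal (norm (w_dag - w_star) / \<epsilon>) * (f w - f w_dag)
           \<le> max_dist f \<Omega> \<epsilon> / ereal \<epsilon> * (f w - f w_dag)"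
    by (simp only: Let_def a_def proj_def)
qed

end
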